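(* Let $\alpha \in \mathbb{R} \setminus \mathbb{Q}$ and let $\{m_l\}_{l\in\mathbb{N}}$ be a sequence of integers such that $\lim_{l\to\infty} \|m_l \alpha\| = 0$. Then there exists a Borel probability measure $\mu$ on $\mathbb{T}$ which has no atoms and such that $$\lim_{l\to\infty} \int_{\mathbb{T}} \|m_l \theta\| \, d\mu(\theta) = 0.$$
   Context: $\mathbb{T} = \mathbb{R}/\mathbb{Z}$ is the circle. For $x \in \mathbb{R}$, $\|x\| := \inf_{n \in \mathbb{Z}} |x - n|$ is the distance from $x$ to the nearest integer; it depends only on the class of $x$ in $\mathbb{T}$, so $\|m\theta\|$ is well defined for $m\in\mathbb{Z}$ and $\theta \in \mathbb{T}$. *)

theory Defs
  imports "HOL-Probability.Probability"
begin

text \<open>The distance \<open>\<parallel>x\<parallel>\<close> from a real \<open>x\<close> to the nearest integer is \<open>infdist x \<int>\<close>,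
  which unfolds to the infimum of \<open>dist x n\<close> over \<open>n \<in> \<int>\<close>.\<close>

quotient_type circle = real / "\<lambda>x y :: real. x - y \<in> \<int>"
  morphisms rep_circle to_circle
proof (rule equivpI)
  show "reflp (\<lambda>x y :: real. x - y \<in> \<int>)"
    by (simp add: reflp_def)
  show "symp (\<lambda>x y :: real. x - y \<in> \<int>)"
    by (auto intro!: sympI dest: Ints_minus)
  show "transp (\<lambda>x y :: real. x - y \<in> \<int>)"
  proof (rule transpI)
    fix x y z :: real
    assume "x - y \<in> \<int>" "y - z \<in> \<int>"
    then have "(x - y) + (y - z) \<in> \<int>" by (rule Ints_add)
    then show "x - z \<in> \<int>" by simp
  qed
qed

text \<open>The quotient topology induced from the real line; \<open>borel :: circle measure\<close> refers to it.\<close>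

instantiation circle :: topological_space
begin

definition open_circle :: "circle set \<Rightarrow> bool" where
  "open_circle U \<longleftrightarrow> open (to_circle -` U)"

instance
proof
  show "open (UNIV :: circle set)" by (simp add: open_circle_def)
  show "open (S \<inter> T)" if "open S" "open T" for S T :: "circle set"
    using that by (simp add: open_circle_def open_Int)
  show "open (\<Union>K)" if "\<forall>S\<in>K. open S" for K :: "circle set set"
    using that by (auto simp: open_circle_def vimage_Union)
qed

end

lift_definition circle_mult :: "int \<Rightarrow> circle \<Rightarrow> circle" is "\<lambda>m x. of_int m * x"
  by (simp add: Ints_mult flip: right_diff_distrib)

lemma infdist_Ints_shift:
  fixes x y :: real
  assumes "x - y \<in> \<int>"
  shows "infdist x \<int> = infdist y \<int>"
proof -
  have le: "infdist u \<int> \<le> infdist v \<int>" if uv: "u - v \<in> \<int>" for u v :: real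
  proof -
    have ne: "(\<int> :: real set) \<noteq> {}" using Ints_0 by blast
    have "infdist u \<int> \<le> dist v a" if a: "a \<in> \<int>" for a
    proof -
      have "infdist u \<int> \<le> dist u (a + (u - v))"
        by (rule infdist_le[OF Ints_add[OF a uv]])
      also have "\<dots> = dist v a" by (simp add: dist_real_def)
      finally show ?thesis .
    qed
    then show ?thesis
      unfolding infdist_notempty[OF ne, of v] by (rule cINF_greatest[OF ne])
  qed
  have yx: "y - x \<in> \<int>" using Ints_minus[OF assms] by simp
  show ?thesis by (rule antisym[OF le[OF assms] le[OF yx]])
qed

lift_definition circle_norm :: "circle \<Rightarrow> real" is "\<lambda>x. infdist x \<int>"
  by (rule infdist_Ints_shift)

text \<open>The next two facts rule out the degenerate conventions of \<open>emeasure\<close> (zero on non-measurable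
  sets) and of the Bochner integral (zero on non-integrable functions) for points of the circle
  and for the functions \<open>\<theta> \<mapsto> \<parallel>m\<theta>\<parallel>\<close>.\<close>

lemma closed_singleton_circle: "closed {\<theta> :: circle}"
proof -
  have "\<exists>x. \<theta> = to_circle x" by (induct \<theta> rule: circle.abs_induct) (rule exI, rule refl)
  then obtain x where x: "\<theta> = to_circle x" ..
  have "to_circle -` {\<theta>} = (\<lambda>y. y - x) -` \<int>"
    by (simp add: set_eq_iff x circle.abs_eq_iff)
  moreover have "closed ((\<lambda>y :: real. y - x) -` \<int>)"
    by (rule closed_vimage[OF closed_Ints]) (intro continuous_intros)
  ultimately have "closed (to_circle -` {\<theta>})" by metis
  then have "open (to_circle -` (- {\<theta>}))" unfolding vimage_Compl by (rule open_Compl)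
  then show ?thesis unfolding closed_def open_circle_def .
qed

lemma circle_norm_mult_borel: "(\<lambda>\<theta>. circle_norm (circle_mult m \<theta>)) \<in> borel_measurable borel"
proof (rule borel_measurable_continuous_onI)
  have "to_circle -` (\<lambda>\<theta>. circle_norm (circle_mult m \<theta>)) -` U
      = (\<lambda>x. infdist (of_int m * x) \<int>) -` U" for U
    by (auto simp: circle_mult.abs_eq circle_norm.abs_eq)
  moreover have "open ((\<lambda>x :: real. infdist (of_int m * x) \<int>) -` U)" if "open U" for U
    by (rule open_vimage[OF that]) (intro continuous_intros)
  ultimately show "continuous_on UNIV (\<lambda>\<theta>. circle_norm (circle_mult m \<theta>))"
    by (simp add: continuous_on_open_vimage open_circle_def)
qed

end

theory Submission
  imports Defs "HOL-Library.Discrete_Functions"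
begin

text \<open>The numbers \<open>\<beta>\<close> with \<open>\<parallel>m\<^sub>l \<beta>\<parallel> \<longlongrightarrow> 0\<close> form a group that contains \<open>\<alpha>\<close> and \<open>1\<close>. As \<open>\<alpha>\<close> is
  irrational, Dirichlet's theorem makes this group accumulate at \<open>0\<close>
  (\<open>frequently_nint_tendsto_0\<close>), so it supplies a sequence of nonzero steps \<open>\<beta>\<^sub>j\<close> that shrink
  as fast as desired. The measure \<open>\<mu>\<close> is the law, modulo 1, of the random sum
  \<open>X(\<omega>) = (\<Sum>j. 1\<^bsub>A\<^sub>j\<^esub>(\<omega>) \<beta>\<^sub>j)\<close>, where \<open>\<omega>\<close> is uniform on \<open>[0,1)\<close> and the sets \<open>A\<^sub>j\<close> separate
  points while their lengths tend to \<open>0\<close>.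

  There are no atoms: the \<open>\<beta>\<^sub>j\<close> decrease so fast that the first step in which two such sums differ
  outweighs all later ones, so \<open>X\<close> is injective modulo 1 (\<open>lacunary_sum_notin_Ints\<close>).

  The integrals tend to \<open>0\<close>: each \<open>\<beta>\<^sub>j\<close> is chosen after a threshold \<open>L\<^sub>j\<close> past which
  \<open>(\<Sum>i<j. \<parallel>m\<^sub>l \<beta>\<^sub>i\<parallel>)\<close> is at most \<open>1/2\<^sup>j\<close>, and so small that \<open>\<bar>m\<^sub>l \<beta>\<^sub>j\<bar> \<le> 1/2\<^sup>j\<close> for the finitely many \<open>l\<close> before
  that threshold (\<open>lacunary_steps_exist\<close>). For \<open>L\<^sub>J \<le> l < L\<^bsub>J+1\<^esub>\<close> the steps before \<open>J\<close> have settled,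
  and those after \<open>J\<close> are not yet visible to \<open>m\<^sub>l\<close>. Only the step \<open>J\<close> itself escapes control, and it
  costs at most the length of \<open>A\<^sub>J\<close>, the probability that it is taken. This is why the lengths of
  the \<open>A\<^sub>j\<close> must tend to \<open>0\<close>: independent fair choices could leave a contribution of order
  one.\<close>

section \<open>Distance to the nearest integer\<close>

abbreviation nint :: "real \<Rightarrow> real" where
  "nint x \<equiv> infdist x \<int>"

lemma nint_le_abs: "nint x \<le> \<bar>x\<bar>"
  using infdist_le[of 0 \<int> x] by (simp add: dist_real_def)

lemma nint_le_1: "nint x \<le> 1"
proof -
  have "nint x \<le> dist x (of_int \<lfloor>x\<rfloor>)" by (rule infdist_le) simp
  also have "\<dots> \<le> 1" unfolding dist_real_def by linarith
  finally show ?thesis .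
qed

lemma nint_add: "nint (x + y) \<le> nint x + nint y"
proof -
  have ne: "(\<int> :: real set) \<noteq> {}" using Ints_0 by blast
  have "nint (x + y) - nint x \<le> dist y b" if b: "b \<in> \<int>" for b
  proof -
    have "nint (x + y) \<le> nint (x + b) + dist (x + y) (x + b)" by (rule infdist_triangle)
    moreover have "nint (x + b) = nint x" using b by (intro infdist_Ints_shift) simp
    ultimately show ?thesis by (simp add: dist_real_def)
  qed
  then have "nint (x + y) - nint x \<le> nint y"
    unfolding infdist_notempty[OF ne, of y] by (intro cINF_greatest[OF ne])
  then show ?thesis by simp
qed

lemma nint_sum: "nint (\<Sum>i\<in>I. f i) \<le> (\<Sum>i\<in>I. nint (f i))"
proof (induction I rule: infinite_finite_induct)
  case (insert i I)
  then show ?case using nint_add[of "f i" "\<Sum>i\<in>I. f i"] by simp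
qed simp_all

lemma nint_nat_mult: "nint (of_nat k * x) \<le> of_nat k * nint x"
  using nint_sum[of "\<lambda>_. x" "{..<k}"] by simp

section \<open>Small steps with the rigidity of the rotation\<close>

text \<open>The witnesses are \<open>k\<alpha> - h\<close>: irrationality makes them nonzero, Dirichlet approximation makes them
  small, and multiplication by the fixed integer \<open>k\<close> preserves the convergence. Being a
  \<open>frequently\<close> statement at \<open>0\<close>, the conclusion can be combined with any finite list of smallness
  requirements.\<close>

lemma frequently_nint_tendsto_0:
  fixes \<alpha> :: real and m :: "nat \<Rightarrow> int"
  assumes \<alpha>: "\<alpha> \<notin> \<rat>" and lim: "(\<lambda>l. nint (of_int (m l) * \<alpha>)) \<longlonglongrightarrow> 0"
  shows "\<exists>\<^sub>F \<beta> in at 0. (\<lambda>l. nint (of_int (m l) * \<beta>)) \<longlonglongrightarrow> 0"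
  unfolding frequently_at
proof (intro allI impI)
  fix d :: real assume "d > 0"
  then obtain n :: nat where n: "n > 0" "1 / real n < d"
    using ex_inverse_of_nat_less by (auto simp: inverse_eq_divide)
  obtain h k where k: "0 < k" and hk: "\<bar>of_int k * \<alpha> - of_int h\<bar> < 1 / real n"
    using Dirichlet_approx[OF n(1), of \<alpha>] by metis
  define \<beta> where "\<beta> = of_int k * \<alpha> - of_int h"
  have "\<beta> \<noteq> 0"
  proof
    assume "\<beta> = 0"
    then have "\<alpha> = of_int h / of_int k" using k by (simp add: \<beta>_def field_simps)
    then show False using \<alpha> by (metis Rats_divide Rats_of_int)
  qed
  moreover have "dist \<beta> 0 < d" using hk n(2) by (simp add: \<beta>_def)
  moreover have "(\<lambda>l. nint (of_int (m l) * \<beta>)) \<longlonglongrightarrow> 0"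
  proof (rule tendsto_sandwich[OF _ _ tendsto_const])
    show "(\<lambda>l. of_nat (nat k) * nint (of_int (m l) * \<alpha>)) \<longlonglongrightarrow> 0"
      using tendsto_mult[OF tendsto_const lim, of "of_nat (nat k)"] by simp
    have "nint (of_int (m l) * \<beta>) \<le> of_nat (nat k) * nint (of_int (m l) * \<alpha>)" for l
    proof -
      have "nint (of_int (m l) * \<beta>) = nint (of_nat (nat k) * (of_int (m l) * \<alpha>))"
        using k by (intro infdist_Ints_shift) (simp add: \<beta>_def algebra_simps)
      then show ?thesis using nint_nat_mult by simp
    qed
    then show "\<forall>\<^sub>F l in sequentially. nint (of_int (m l) * \<beta>) \<le> of_nat (nat k) * nint (of_int (m l) * \<alpha>)"
      by simp
  qed (simp add: infdist_nonneg)
  ultimately show "\<exists>\<beta>\<in>UNIV. \<beta> \<noteq> 0 \<and> dist \<beta> 0 < d \<and> (\<lambda>l. nint (of_int (m l) * \<beta>)) \<longlonglongrightarrow> 0"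
    by blast
qed

text \<open>A recursion: given the steps before \<open>j\<close>, first take the threshold \<open>L j\<close>, which exists because a
  finite sum of null sequences is a null sequence, and then the step \<open>\<beta> j\<close>, subject to
  finitely many conditions that hold near \<open>0\<close>.\<close>

lemma lacunary_steps_exist:
  fixes m :: "nat \<Rightarrow> int"
  assumes freq: "\<exists>\<^sub>F \<beta> in at 0. (\<lambda>l. nint (of_int (m l) * \<beta>)) \<longlonglongrightarrow> 0"
  obtains \<beta> :: "nat \<Rightarrow> real" and L :: "nat \<Rightarrow> nat"
  where "\<And>j. \<beta> j \<noteq> 0"
    and "\<And>j. \<bar>\<beta> j\<bar> \<le> 1 / 4 ^ Suc j"
    and "\<And>i j. i < j \<Longrightarrow> \<bar>\<beta> j\<bar> \<le> \<bar>\<beta> i\<bar> / 4 ^ (j - i)"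
    and "mono L"
    and "\<And>j. j \<le> L j"
    and "\<And>j l. L j \<le> l \<Longrightarrow> (\<Sum>i<j. nint (of_int (m l) * \<beta> i)) \<le> 1 / 2 ^ j"
    and "\<And>j l. l < L j \<Longrightarrow> \<bar>of_int (m l) * \<beta> j\<bar> \<le> 1 / 2 ^ j"
proof -
  \<comment> \<open>The convergence clause is what lets the next threshold be found.\<close>
  define P :: "(nat \<Rightarrow> real \<times> nat) \<Rightarrow> nat \<Rightarrow> real \<times> nat \<Rightarrow> bool" where
    "P = (\<lambda>f j (b, L). b \<noteq> 0 \<and> \<bar>b\<bar> \<le> 1 / 4 ^ Suc j
       \<and> (\<forall>i<j. \<bar>b\<bar> \<le> \<bar>fst (f i)\<bar> / 4 ^ (j - i))
       \<and> (\<forall>i<j. snd (f i) \<le> L) \<and> j \<le> L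
       \<and> (\<forall>l\<ge>L. (\<Sum>i<j. nint (of_int (m l) * fst (f i))) \<le> 1 / 2 ^ j)
       \<and> (\<forall>l<L. \<bar>of_int (m l) * b\<bar> \<le> 1 / 2 ^ j)
       \<and> (\<lambda>l. nint (of_int (m l) * b)) \<longlonglongrightarrow> 0)"
  have "\<exists>f. \<forall>j. P f j (f j)"
  proof (rule dependent_wellorder_choice)
    fix r :: "real \<times> nat" and f g :: "nat \<Rightarrow> real \<times> nat" and j :: nat
    assume fg: "\<And>i. i < j \<Longrightarrow> f i = g i"
    have "(\<Sum>i<j. nint (of_int (m l) * fst (f i))) = (\<Sum>i<j. nint (of_int (m l) * fst (g i)))" for l
      using fg by simp
    then show "P f j r = P g j r" using fg by (simp add: P_def split_beta)
  next
    fix j :: nat and f :: "nat \<Rightarrow> real \<times> nat"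
    assume prev: "\<And>i. i < j \<Longrightarrow> P f i (f i)"
    have lim: "(\<lambda>l. nint (of_int (m l) * fst (f i))) \<longlonglongrightarrow> 0" and nz: "fst (f i) \<noteq> 0" if "i < j" for i
      using prev[OF that] by (auto simp: P_def split_beta)
    have "(\<lambda>l. \<Sum>i<j. nint (of_int (m l) * fst (f i))) \<longlonglongrightarrow> 0"
      by (rule tendsto_null_sum) (use lim in auto)
    then have "\<forall>\<^sub>F l in sequentially. (\<Sum>i<j. nint (of_int (m l) * fst (f i))) < 1 / 2 ^ j"
      by (rule order_tendstoD) simp
    then obtain L0 where L0: "\<And>l. L0 \<le> l \<Longrightarrow> (\<Sum>i<j. nint (of_int (m l) * fst (f i))) < 1 / 2 ^ j"
      unfolding eventually_sequentially by blast
    define L where "L = L0 + j + (\<Sum>i<j. snd (f i))"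
    have L: "snd (f i) \<le> L" if "i < j" for i
      using member_le_sum[of i "{..<j}" "\<lambda>i. snd (f i)"] that by (simp add: L_def)
    have small: "\<forall>\<^sub>F b in at (0::real). \<bar>a * b\<bar> \<le> c" if "c > 0" for a c :: real
    proof -
      have "((\<lambda>b. \<bar>a * b\<bar>) \<longlongrightarrow> \<bar>a * 0\<bar>) (at 0)" by (intro tendsto_intros)
      then have "\<forall>\<^sub>F b in at (0::real). \<bar>a * b\<bar> < c" using that by (intro order_tendstoD(2)) auto
      then show ?thesis by eventually_elim simp
    qed
    have "\<forall>\<^sub>F b in at (0::real). \<bar>b\<bar> \<le> 1 / 4 ^ Suc j"
      using small[of "1 / 4 ^ Suc j" 1] by simp
    moreover have "\<forall>\<^sub>F b in at (0::real). \<forall>i\<in>{..<j}. \<bar>b\<bar> \<le> \<bar>fst (f i)\<bar> / 4 ^ (j - i)"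
      using small[of "\<bar>fst (f i)\<bar> / 4 ^ (j - i)" 1 for i] nz by (intro eventually_ball_finite) auto
    moreover have "\<forall>\<^sub>F b in at (0::real). \<forall>l\<in>{..<L}. \<bar>of_int (m l) * b\<bar> \<le> 1 / 2 ^ j"
      by (intro eventually_ball_finite ballI small) auto
    moreover have "\<forall>\<^sub>F b in at (0::real). b \<noteq> 0" by (simp add: eventually_at_filter)
    ultimately have "\<forall>\<^sub>F b in at (0::real). b \<noteq> 0 \<and> \<bar>b\<bar> \<le> 1 / 4 ^ Suc j
        \<and> (\<forall>i\<in>{..<j}. \<bar>b\<bar> \<le> \<bar>fst (f i)\<bar> / 4 ^ (j - i)) \<and> (\<forall>l\<in>{..<L}. \<bar>of_int (m l) * b\<bar> \<le> 1 / 2 ^ j)"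
      by eventually_elim blast
    from frequently_ex[OF frequently_eventually_conj[OF freq this]]
    obtain b where "(\<lambda>l. nint (of_int (m l) * b)) \<longlonglongrightarrow> 0" "b \<noteq> 0" "\<bar>b\<bar> \<le> 1 / 4 ^ Suc j"
        "\<forall>i\<in>{..<j}. \<bar>b\<bar> \<le> \<bar>fst (f i)\<bar> / 4 ^ (j - i)" "\<forall>l\<in>{..<L}. \<bar>of_int (m l) * b\<bar> \<le> 1 / 2 ^ j"
      by blast
    then have "P f j (b, L)"
      unfolding P_def using L L0 by (auto simp: L_def intro: less_imp_le)
    then show "\<exists>r. P f j r" ..
  qed
  then obtain f where f: "\<And>j. P f j (f j)" by blast
  show thesis
  proof (rule that[of "fst \<circ> f" "snd \<circ> f"])
    show "mono (snd \<circ> f)"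
    proof (rule monoI)
      fix i j :: nat assume "i \<le> j"
      then show "(snd \<circ> f) i \<le> (snd \<circ> f) j"
        using f[of j] by (cases "i = j") (auto simp: P_def split_beta)
    qed
  qed (use f in \<open>auto simp: P_def split_beta\<close>)
qed

section \<open>Lacunary sums\<close>

text \<open>If \<open>k\<close> is the first index with \<open>d k \<noteq> 0\<close>, the remaining terms amount to at most
  \<open>\<bar>\<beta> k\<bar> * (1/4 + 1/16 + \<dots>) = \<bar>\<beta> k\<bar> / 3\<close>. The sum is therefore nonzero, and it is smaller than \<open>1\<close>.
  Applied to differences of indicators, this gives injectivity modulo 1 of the random sum.\<close>

lemma lacunary_sum_notin_Ints:
  fixes \<beta> d :: "nat \<Rightarrow> real"
  assumes nz: "\<And>j. \<beta> j \<noteq> 0"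
    and bound: "\<And>j. \<bar>\<beta> j\<bar> \<le> 1 / 4 ^ Suc j"
    and decay: "\<And>i j. i < j \<Longrightarrow> \<bar>\<beta> j\<bar> \<le> \<bar>\<beta> i\<bar> / 4 ^ (j - i)"
    and d: "\<And>j. d j \<in> {-1, 0, 1}" and ex: "\<exists>j. d j \<noteq> 0"
  shows "(\<Sum>j. d j * \<beta> j) \<notin> \<int>"
proof -
  define k where "k = (LEAST j. d j \<noteq> 0)"
  have k: "d k \<noteq> 0" using ex unfolding k_def by (rule LeastI_ex)
  have below: "d j = 0" if "j < k" for j using that not_less_Least unfolding k_def by blast
  have dle: "\<bar>d j\<bar> \<le> 1" for j using d[of j] by auto
  have tail: "norm (d (n + Suc k) * \<beta> (n + Suc k)) \<le> \<bar>\<beta> k\<bar> * (1 / 4) ^ Suc n" for n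
  proof -
    have "norm (d (n + Suc k) * \<beta> (n + Suc k)) \<le> 1 * \<bar>\<beta> (n + Suc k)\<bar>"
      unfolding real_norm_def abs_mult by (intro mult_right_mono dle) simp
    also have "\<dots> \<le> \<bar>\<beta> k\<bar> * (1 / 4) ^ Suc n"
      using decay[of k "n + Suc k"] by (simp add: power_divide)
    finally show ?thesis .
  qed
  have geo: "(\<lambda>n. \<bar>\<beta> k\<bar> * (1 / 4) ^ Suc n) sums (\<bar>\<beta> k\<bar> * ((1 / 4) * (1 / (1 - 1 / 4))))"
    using geometric_sums[of "1 / 4 :: real"] unfolding power_Suc by (intro sums_mult) simp
  define t where "t = (\<Sum>n. d (n + Suc k) * \<beta> (n + Suc k))"
  have smt: "summable (\<lambda>n. d (n + Suc k) * \<beta> (n + Suc k))"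
    by (rule summable_comparison_test'[OF sums_summable[OF geo]]) (rule tail)
  have t: "\<bar>t\<bar> \<le> \<bar>\<beta> k\<bar> / 3"
    using norm_suminf_le[OF tail sums_summable[OF geo]] sums_unique[OF geo] by (simp add: t_def)
  have "(\<Sum>j. d j * \<beta> j) = t + (\<Sum>j<Suc k. d j * \<beta> j)"
    unfolding t_def using smt by (intro suminf_split_initial_segment) (subst (asm) summable_iff_shift)
  also have "\<dots> = t + d k * \<beta> k" using below by simp
  finally have eq: "(\<Sum>j. d j * \<beta> j) = t + d k * \<beta> k" .
  have dk: "\<bar>d k * \<beta> k\<bar> = \<bar>\<beta> k\<bar>" using d[of k] k by (auto simp: abs_mult)
  have pos: "\<bar>\<beta> k\<bar> > 0" using nz by simp
  have "\<bar>\<beta> k\<bar> \<le> 1 / 4"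
  proof -
    have "1 / 4 ^ Suc k \<le> (1 / 4 :: real)" by (simp add: field_simps)
    then show ?thesis using bound[of k] by linarith
  qed
  then have "\<bar>t + d k * \<beta> k\<bar> < 1" "t + d k * \<beta> k \<noteq> 0" using dk pos t by linarith+
  then show ?thesis unfolding eq using Ints_nonzero_abs_less1 by blast
qed

section \<open>Short intervals that separate points\<close>

text \<open>For each \<open>n > 0\<close> the indices \<open>j = n\<^sup>2 + i\<close> with \<open>i \<le> 2n\<close> sweep over the consecutive intervals of
  length \<open>1/n\<close> that start at \<open>0\<close>; there are more than enough of them to cover \<open>[0,1)\<close>. This is
  the typewriter sequence, with squares as block boundaries. For \<open>j = 0\<close> the interval is
  \<open>{0..<0}\<close>, since \<open>x / 0 = 0\<close>.\<close>

definition sweep :: "nat \<Rightarrow> real set" where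
  "sweep j = (let n = floor_sqrt j; i = j - n\<^sup>2 in {real i / real n ..< (real i + 1) / real n})"

lemma sweep_borel [measurable]: "sweep j \<in> sets borel"
  by (simp add: sweep_def Let_def)

lemma sweep_fmeasurable: "sweep j \<in> fmeasurable lborel"
  by (rule fmeasurableI) (simp, simp add: sweep_def Let_def divide_right_mono)

lemma measure_sweep_tendsto_0: "(\<lambda>j. measure lborel (sweep j)) \<longlonglongrightarrow> 0"
proof -
  have "filterlim floor_sqrt at_top sequentially"
    unfolding filterlim_at_top eventually_sequentially by (meson le_floor_sqrt_iff)
  then have "(\<lambda>j. 1 / real (floor_sqrt j)) \<longlonglongrightarrow> 0"
    using filterlim_compose[OF lim_1_over_n] by blast
  moreover have "measure lborel (sweep j) = 1 / real (floor_sqrt j)" for j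
    by (simp add: sweep_def Let_def divide_right_mono flip: diff_divide_distrib)
  ultimately show ?thesis by simp
qed

lemma sweep_separates:
  assumes x: "0 \<le> x" "x < 1" and "x \<noteq> y"
  shows "\<exists>j. x \<in> sweep j \<and> y \<notin> sweep j"
proof -
  obtain n :: nat where n: "n > 0" "1 / real n < \<bar>x - y\<bar>"
    using ex_inverse_of_nat_less[of "\<bar>x - y\<bar>"] \<open>x \<noteq> y\<close> by (auto simp: inverse_eq_divide)
  define i where "i = nat \<lfloor>real n * x\<rfloor>"
  have i: "real i \<le> real n * x" "real n * x < real i + 1"
    using x by (simp_all add: i_def)
  have "real n * x < real n" using x n by simp
  then have "i < n" using i by linarith
  then have "floor_sqrt (n\<^sup>2 + i) = n"
    by (intro floor_sqrt_unique) (auto simp: power2_eq_square)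
  then have eq: "sweep (n\<^sup>2 + i) = {real i / real n ..< (real i + 1) / real n}"
    by (simp add: sweep_def)
  have "x \<in> sweep (n\<^sup>2 + i)" unfolding eq using i n by (simp add: field_simps)
  moreover have "y \<notin> sweep (n\<^sup>2 + i)"
    using calculation n unfolding eq by (auto simp: add_divide_distrib)
  ultimately show ?thesis by blast
qed

section \<open>The law of the random sum\<close>

theorem theorem1:
  fixes \<alpha> :: real and m :: "nat \<Rightarrow> int"
  assumes "\<alpha> \<notin> \<rat>"
    and "(\<lambda>l. infdist (of_int (m l) * \<alpha>) \<int>) \<longlonglongrightarrow> 0"
  shows "\<exists>\<mu> :: circle measure.
    sets \<mu> = sets borel \<and> prob_space \<mu> \<and>
    (\<forall>\<theta>. emeasure \<mu> {\<theta>} = 0) \<and>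
    (\<lambda>l. LINT \<theta>|\<mu>. circle_norm (circle_mult (m l) \<theta>)) \<longlonglongrightarrow> 0"
proof -
  obtain \<beta> :: "nat \<Rightarrow> real" and L :: "nat \<Rightarrow> nat"
    where nz: "\<And>j. \<beta> j \<noteq> 0"
    and bound: "\<And>j. \<bar>\<beta> j\<bar> \<le> 1 / 4 ^ Suc j"
    and decay: "\<And>i j. i < j \<Longrightarrow> \<bar>\<beta> j\<bar> \<le> \<bar>\<beta> i\<bar> / 4 ^ (j - i)"
    and L: "mono L" "\<And>j. j \<le> L j"
    and early: "\<And>j l. L j \<le> l \<Longrightarrow> (\<Sum>i<j. nint (of_int (m l) * \<beta> i)) \<le> 1 / 2 ^ j"
    and late: "\<And>j l. l < L j \<Longrightarrow> \<bar>of_int (m l) * \<beta> j\<bar> \<le> 1 / 2 ^ j"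
    using lacunary_steps_exist[OF frequently_nint_tendsto_0[OF assms]] by metis
  define M :: "real measure" where "M = restrict_space lborel {0..<1}"
  interpret M: prob_space M
    unfolding M_def by (rule prob_space_restrict_space) simp_all
  have space_M: "space M = {0..<1}" by (simp add: M_def space_restrict_space)
  have borel_M: "f \<in> borel_measurable M" if "f \<in> borel_measurable borel" for f :: "real \<Rightarrow> real"
    unfolding M_def using that by (intro measurable_restrict_space1) simp
  define X where "X = (\<lambda>\<omega>. \<Sum>j. indicator (sweep j) \<omega> * \<beta> j)"
  have X_borel: "X \<in> borel_measurable borel" unfolding X_def by measurable
  note X_M = borel_M[OF X_borel]
  have summ: "summable (\<lambda>j. indicator (sweep j) \<omega> * \<beta> j)" for \<omega>
  proof (rule summable_comparison_test')
    show "summable (\<lambda>j. (1 / 4 :: real) ^ Suc j)"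
      using summable_geometric[of "1 / 4 :: real"] by (simp add: summable_Suc_iff)
    show "norm (indicator (sweep j) \<omega> * \<beta> j) \<le> (1 / 4) ^ Suc j" for j
      using bound[of j] by (auto simp: indicator_def power_divide)
  qed
  have X_inj: "x = y" if xy: "x \<in> {0..<1}" "X x - X y \<in> \<int>" for x y
  proof (rule ccontr)
    assume "x \<noteq> y"
    define d :: "nat \<Rightarrow> real" where "d = (\<lambda>j. indicator (sweep j) x - indicator (sweep j) y)"
    obtain j where "x \<in> sweep j" "y \<notin> sweep j"
      using sweep_separates[of x y] xy \<open>x \<noteq> y\<close> by auto
    then have "\<exists>j. d j \<noteq> 0" by (intro exI[of _ j]) (simp add: d_def)
    then have "(\<Sum>j. d j * \<beta> j) \<notin> \<int>"
      by (intro lacunary_sum_notin_Ints nz bound decay) (auto simp: d_def indicator_def)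
    moreover have "(\<Sum>j. d j * \<beta> j) = X x - X y"
      unfolding X_def d_def left_diff_distrib by (rule suminf_diff[symmetric]) (rule summ)+
    ultimately show False using xy by simp
  qed
  have to_circle_borel: "to_circle \<in> borel_measurable borel"
    by (rule borel_measurable_continuous_onI) (simp add: continuous_on_open_vimage open_circle_def)
  define Y where "Y = (\<lambda>\<omega>. to_circle (X \<omega>))"
  have Y: "Y \<in> M \<rightarrow>\<^sub>M borel" unfolding Y_def by (rule measurable_compose[OF X_M to_circle_borel])
  define \<mu> where "\<mu> = distr M borel Y"
  have atoms: "emeasure \<mu> {\<theta>} = 0" for \<theta>
  proof -
    have "{\<theta>} \<in> sets borel" using closed_singleton_circle by (rule borel_closed)
    then have "emeasure \<mu> {\<theta>} = emeasure M (Y -` {\<theta>} \<inter> space M)"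
      unfolding \<mu>_def by (rule emeasure_distr[OF Y])
    also have "\<dots> = emeasure lborel (Y -` {\<theta>} \<inter> space M)"
      unfolding space_M unfolding M_def by (rule emeasure_restrict_space) auto
    also have "\<dots> = 0"
    proof (rule emeasure_lborel_countable)
      have "\<exists>x. Y -` {\<theta>} \<inter> space M \<subseteq> {x}"
      proof (cases "Y -` {\<theta>} \<inter> space M = {}")
        case False
        then obtain x where "Y x = \<theta>" by blast
        then have "Y -` {\<theta>} \<inter> space M \<subseteq> {x}"
          using X_inj by (auto simp: space_M Y_def circle.abs_eq_iff)
        then show ?thesis ..
      qed simp
      then show "countable (Y -` {\<theta>} \<inter> space M)" by (meson countable_subset countable_finite finite.simps)
    qed
    finally show ?thesis .
  qed
  \<comment> \<open>The bound on the integral for \<open>L J \<le> l < L (Suc J)\<close>: early steps, late steps, and the step \<open>J\<close>.\<close>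
  define e where "e = (\<lambda>J. 1 / 2 ^ J + 1 / 2 ^ J + measure lborel (sweep J))"
  have e: "e \<longlonglongrightarrow> 0"
  proof -
    have "(\<lambda>J. 1 / 2 ^ J :: real) \<longlonglongrightarrow> 0"
      using LIMSEQ_realpow_zero[of "1 / 2 :: real"] by (simp add: power_divide)
    from tendsto_add[OF tendsto_add[OF this this] measure_sweep_tendsto_0]
    show ?thesis by (simp add: e_def)
  qed
  have point: "nint (of_int (m l) * X \<omega>) \<le> 1 / 2 ^ J + 1 / 2 ^ J + indicator (sweep J) \<omega>"
    if l: "L J \<le> l" "l < L (Suc J)" for l J \<omega>
  proof -
    define g where "g = (\<lambda>j. of_int (m l) * (indicator (sweep j) \<omega> * \<beta> j))"
    have g: "summable g" unfolding g_def by (intro summable_mult summ)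
    have "of_int (m l) * X \<omega> = suminf g"
      unfolding X_def g_def by (rule suminf_mult[symmetric, OF summ])
    also have "\<dots> = (\<Sum>n. g (n + Suc J)) + (\<Sum>j<J. g j) + g J"
      using suminf_split_initial_segment[OF g, of "Suc J"] by simp
    finally have "nint (of_int (m l) * X \<omega>) \<le> nint (\<Sum>n. g (n + Suc J)) + nint (\<Sum>j<J. g j) + nint (g J)"
      using nint_add[of "(\<Sum>n. g (n + Suc J)) + (\<Sum>j<J. g j)" "g J"]
        nint_add[of "\<Sum>n. g (n + Suc J)" "\<Sum>j<J. g j"] by simp
    moreover have "nint (\<Sum>n. g (n + Suc J)) \<le> 1 / 2 ^ J"
    proof -
      have "norm (g (n + Suc J)) \<le> 1 / 2 ^ Suc J * (1 / 2) ^ n" for n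
      proof -
        have "l < L (n + Suc J)" using l(2) monoD[OF L(1), of "Suc J" "n + Suc J"] by simp
        then have "\<bar>of_int (m l) * \<beta> (n + Suc J)\<bar> \<le> 1 / 2 ^ (n + Suc J)" by (rule late)
        then show ?thesis by (simp add: g_def indicator_def power_add power_divide mult_ac)
      qed
      moreover have geo: "(\<lambda>n. 1 / 2 ^ Suc J * (1 / 2) ^ n) sums (1 / 2 ^ Suc J * (1 / (1 - 1 / 2) :: real))"
        by (intro sums_mult geometric_sums) simp
      ultimately have "norm (\<Sum>n. g (n + Suc J)) \<le> (\<Sum>n. 1 / 2 ^ Suc J * (1 / 2) ^ n)"
        by (intro norm_suminf_le sums_summable[OF geo])
      then show ?thesis using nint_le_abs[of "\<Sum>n. g (n + Suc J)"] sums_unique[OF geo] by simp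
    qed
    moreover have "nint (\<Sum>j<J. g j) \<le> 1 / 2 ^ J"
    proof -
      have "nint (\<Sum>j<J. g j) \<le> (\<Sum>j<J. nint (g j))" by (rule nint_sum)
      also have "\<dots> \<le> (\<Sum>j<J. nint (of_int (m l) * \<beta> j))"
        by (intro sum_mono) (simp add: g_def indicator_def infdist_nonneg)
      also have "\<dots> \<le> 1 / 2 ^ J" using l(1) by (rule early)
      finally show ?thesis .
    qed
    moreover have "nint (g J) \<le> indicator (sweep J) \<omega>"
      by (simp add: g_def indicator_def nint_le_1)
    ultimately show ?thesis by linarith
  qed
  define I where "I = (\<lambda>l. LINT \<theta>|\<mu>. circle_norm (circle_mult (m l) \<theta>))"
  have I: "I l = (LINT \<omega>|M. nint (of_int (m l) * X \<omega>))" for l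
    unfolding I_def \<mu>_def integral_distr[OF Y circle_norm_mult_borel]
    by (simp add: Y_def circle_mult.abs_eq circle_norm.abs_eq)
  have I_nonneg: "0 \<le> I l" for l
    unfolding I by (intro integral_nonneg_AE) (simp add: infdist_nonneg)
  have I_le: "I l \<le> e J" if l: "L J \<le> l" "l < L (Suc J)" for l J
  proof -
    have ind: "(indicator (sweep J) :: real \<Rightarrow> real) \<in> borel_measurable M" by (rule borel_M) measurable
    have int_ind: "integrable M (indicator (sweep J) :: real \<Rightarrow> real)"
      using ind by (intro M.integrable_const_bound[where B = 1]) (auto simp: indicator_def)
    have nint_borel: "(\<lambda>\<omega>. nint (of_int (m l) * X \<omega>)) \<in> borel_measurable borel"
    proof -
      have "(\<lambda>x. nint (of_int (m l) * x)) \<in> borel_measurable borel"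
        by (intro borel_measurable_continuous_onI continuous_intros)
      from measurable_compose[OF X_borel this] show ?thesis .
    qed
    have "I l \<le> (LINT \<omega>|M. 1 / 2 ^ J + 1 / 2 ^ J + indicator (sweep J) \<omega>)"
      unfolding I
    proof (rule integral_mono)
      show "integrable M (\<lambda>\<omega>. nint (of_int (m l) * X \<omega>))"
        using borel_M[OF nint_borel]
        by (intro M.integrable_const_bound[where B = 1]) (auto simp: infdist_nonneg nint_le_1)
    qed (use int_ind point[OF l] in auto)
    also have "\<dots> = 1 / 2 ^ J + 1 / 2 ^ J + (LINT \<omega>|M. indicator (sweep J) \<omega>)"
      using int_ind by (simp add: M.prob_space)
    also have "(LINT \<omega>|M. indicator (sweep J) \<omega>) \<le> measure lborel (sweep J)"
    proof -
      have "(LINT \<omega>|M. indicator (sweep J) \<omega>) = measure M (sweep J \<inter> {0..<1})"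
        by (simp add: space_M)
      also have "\<dots> = measure lborel (sweep J \<inter> {0..<1})"
        unfolding M_def by (rule measure_restrict_space) auto
      also have "\<dots> \<le> measure lborel (sweep J)"
        by (rule measure_mono_fmeasurable[OF _ _ sweep_fmeasurable]) auto
      finally show ?thesis .
    qed
    finally show ?thesis by (simp add: e_def)
  qed
  \<comment> \<open>As \<open>j \<le> L j\<close>, every \<open>l \<ge> L K\<close> lies in a block \<open>L J \<le> l < L (Suc J)\<close> with \<open>J \<ge> K\<close>.\<close>
  have "I \<longlonglongrightarrow> 0"
  proof (rule LIMSEQ_I)
    fix r :: real assume "r > 0"
    then have "\<forall>\<^sub>F J in sequentially. e J < r" by (rule order_tendstoD(2)[OF e])
    then obtain K where K: "\<And>J. K \<le> J \<Longrightarrow> e J < r" unfolding eventually_sequentially by blast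
    have "I l < r" if "L K \<le> l" for l
    proof -
      define J where "J = (GREATEST J. L J \<le> l)"
      have le: "J \<le> l" if "L J \<le> l" for J using L(2)[of J] that by linarith
      have "L J \<le> l" unfolding J_def using that le by (rule GreatestI_nat)
      moreover have "K \<le> J" unfolding J_def using that le by (rule Greatest_le_nat)
      moreover have "l < L (Suc J)"
      proof (rule ccontr)
        assume "\<not> l < L (Suc J)"
        then have "Suc J \<le> J" unfolding J_def by (intro Greatest_le_nat[where b = l]) (use le in auto)
        then show False by simp
      qed
      ultimately show ?thesis using I_le K by (meson le_less_trans)
    qed
    then show "\<exists>no. \<forall>l\<ge>no. norm (I l - 0) < r" using I_nonneg by auto
  qed
  moreover have "sets \<mu> = sets borel" by (simp add: \<mu>_def)
  moreover have "prob_space \<mu>" unfolding \<mu>_def by (rule M.prob_space_distr[OF Y])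
  ultimately show ?thesis using atoms unfolding I_def by blast
qed

end
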